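(* Let $V=\mathbb{C}x+\mathbb{C}y+\mathbb{C}z$ with the action of the Heisenberg group $H_3$ given by $e_1\cdot x=z,\ e_1\cdot y=x,\ e_1\cdot z=y$, $e_2\cdot x=x,\ e_2\cdot y=\omega y,\ e_2\cdot z=\omega^2 z$ ($\omega$ a primitive third root of unity), extended diagonally to tensor powers. For $p=[a:b:c]\in\mathbb{P}^2$ let $W_p\subset V\otimes V$ be the span of $ayz+bzy+cx^2,\ azx+bxz+cy^2,\ axy+byx+cz^2$. Then for each $p\in\{[1:0:0],[0:1:0],[0:0:1]\}$ (the vertices of $\mathbf{V}(abc)$), one has $W_p\otimes V\cap V\otimes W_p\cong \chi_{0,0}\oplus\chi_{1,0}\oplus\chi_{2,0}$ as $H_3$-representations; in particular $(W_p\otimes V\cap V\otimes W_p)^{H_3}$ is 1-dimensional.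
   Context: $H_3=\langle e_1,e_2\mid [e_1,e_2]\text{ central},\ e_1^3=e_2^3=1\rangle$. $\chi_{a,b}$ is the 1-dimensional representation with $\chi_{a,b}(e_1)=\omega^a$, $\chi_{a,b}(e_2)=\omega^b$. The intersection is taken inside $V\otimes V\otimes V$. *)

theory Defs
  imports "HOL-Analysis.Analysis"
begin

(* V = C x + C y + C z is modelled as complex^3; index 0,1,2 :: 3 stand for x,y,z.
   V (x) V is complex^(3*3), V (x) V (x) V is complex^(3*3*3) (coefficients w.r.t.
   the monomial basis), with complex scalar multiplication *s. *)

type_synonym vecV = "complex ^ 3"
type_synonym ten2 = "complex ^ (3 \<times> 3)"
type_synonym ten3 = "complex ^ (3 \<times> 3 \<times> 3)"

(* elementary tensor basis of V (x) V *)
definition E2 :: "3 \<Rightarrow> 3 \<Rightarrow> ten2" where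
  "E2 i j = (\<chi> p. if p = (i, j) then 1 else 0)"

(* tensor products (w (x) v) and (v (x) w) in V (x) V (x) V *)
definition tens21 :: "ten2 \<Rightarrow> vecV \<Rightarrow> ten3" where
  "tens21 w v = (\<chi> p. case p of (i, j, k) \<Rightarrow> w $ (i, j) * v $ k)"

definition tens12 :: "vecV \<Rightarrow> ten2 \<Rightarrow> ten3" where
  "tens12 v w = (\<chi> p. case p of (i, j, k) \<Rightarrow> v $ i * w $ (j, k))"

(* W_p for p = [a:b:c]: span of a yz + b zy + c x^2, a zx + b xz + c y^2, a xy + b yx + c z^2 *)
definition Wp :: "complex \<Rightarrow> complex \<Rightarrow> complex \<Rightarrow> ten2 set" where
  "Wp a b c = vec.span
     { a *s E2 1 2 + b *s E2 2 1 + c *s E2 0 0,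
       a *s E2 2 0 + b *s E2 0 2 + c *s E2 1 1,
       a *s E2 0 1 + b *s E2 1 0 + c *s E2 2 2 }"

(* W (x) V  and  V (x) W  as subspaces of V (x) V (x) V *)
definition WtV :: "ten2 set \<Rightarrow> ten3 set" where
  "WtV W = vec.span {tens21 w v | w v. w \<in> W}"

definition VtW :: "ten2 set \<Rightarrow> ten3 set" where
  "VtW W = vec.span {tens12 v w | v w. w \<in> W}"

(* e2 acts on the basis vector with index i by the scalar pw omega i:
   x \<mapsto> x, y \<mapsto> omega y, z \<mapsto> omega^2 z *)
definition pw :: "complex \<Rightarrow> 3 \<Rightarrow> complex" where
  "pw \<omega> i = (if i = 0 then 1 else if i = 1 then \<omega> else \<omega> ^ 2)"

(* action of e1 on V: x \<mapsto> z, y \<mapsto> x, z \<mapsto> y, i.e. the coefficient of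
   basis vector i after the action is the old coefficient of basis vector i+1 *)
definition act1V :: "vecV \<Rightarrow> vecV" where
  "act1V v = (\<chi> i. v $ (i + 1))"

definition act2V :: "complex \<Rightarrow> vecV \<Rightarrow> vecV" where
  "act2V \<omega> v = (\<chi> i. pw \<omega> i * v $ i)"

(* diagonal actions on V (x) V (x) V *)
definition act1 :: "ten3 \<Rightarrow> ten3" where
  "act1 T = (\<chi> p. case p of (i, j, k) \<Rightarrow> T $ (i + 1, j + 1, k + 1))"

definition act2 :: "complex \<Rightarrow> ten3 \<Rightarrow> ten3" where
  "act2 \<omega> T = (\<chi> p. case p of (i, j, k) \<Rightarrow> pw \<omega> i * pw \<omega> j * pw \<omega> k * T $ (i, j, k))"

(* the representation chi_{0,0} (+) chi_{1,0} (+) chi_{2,0} on complex^3: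
   coordinate a carries chi_{a,0}: e1 acts by omega^a, e2 acts by omega^0 = 1 *)
definition chiSum_e1 :: "complex \<Rightarrow> vecV \<Rightarrow> vecV" where
  "chiSum_e1 \<omega> u = (\<chi> a. pw \<omega> a * u $ a)"

definition chiSum_e2 :: "complex \<Rightarrow> vecV \<Rightarrow> vecV" where
  "chiSum_e2 \<omega> u = u"

end

theory Submission
  imports Defs
begin

text \<open>Index the basis \<open>x, y, z\<close> of \<open>V\<close> by \<open>\<int>/3\<close>. At a vertex of \<open>V(abc)\<close> the space
  \<open>W\<^sub>p\<close> is spanned by the three monomials \<open>x(i) x(i + e)\<close> for a fixed shift \<open>e\<close>, so
  \<open>W\<^sub>p \<otimes> V \<inter> V \<otimes> W\<^sub>p\<close> is spanned by the cubic monomials \<open>m(i) = x(i) x(i + e) x(i + 2e)\<close>.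
  The generator \<open>e\<^sub>2\<close> fixes each \<open>m(i)\<close>, its weight being \<open>\<omega>^(3i + 3e) = 1\<close>, while \<open>e\<^sub>1\<close>
  permutes them cyclically. Hence the intersection is the regular representation of \<open>\<int>/3\<close>,
  and the discrete Fourier transform \<open>\<Sum>\<^sub>i \<omega>^(a i) m(i)\<close> splits it into the characters
  \<open>\<chi>\<^sub>a\<^sub>,\<^sub>0\<close>; the invariants are the image of the trivial summand.\<close>

lemma three_eq_zero: "(3 :: 3) = 0"
  by simp

lemma exhaust_3_from_0: "i = 0 \<or> i = 1 \<or> i = (2::3)"
  using exhaust_3[of i] unfolding three_eq_zero by blast

lemma sum_3_from_0: "(\<Sum>i\<in>UNIV. f i) = f 0 + f 1 + f (2::3)"
  using sum_3[of f] unfolding three_eq_zero by (simp add: ac_simps)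

lemma span_axis_eq_support:
  "vec.span ((\<lambda>q. axis q 1) ` {q. P q}) = {x :: 'a::field ^ 'n. \<forall>q. \<not> P q \<longrightarrow> x $ q = 0}"
  (is "_ = ?V")
proof
  show "vec.span ((\<lambda>q. axis q 1) ` {q. P q}) \<subseteq> ?V"
    by (rule vec.span_minimal) (auto simp: axis_def vec.subspace_def)
next
  show "?V \<subseteq> vec.span ((\<lambda>q. axis q 1) ` {q. P q})"
  proof
    fix x assume x: "x \<in> ?V"
    have "(\<Sum>q\<in>UNIV. x $ q *s axis q 1) \<in> vec.span ((\<lambda>q. axis q 1) ` {q. P q})"
    proof (rule vec.span_sum)
      fix q
      show "x $ q *s axis q 1 \<in> vec.span ((\<lambda>q. axis q 1) ` {q. P q})"
        using x by (cases "P q") (auto intro: vec.span_scale vec.span_base vec.span_zero)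
    qed
    then show "x \<in> vec.span ((\<lambda>q. axis q 1) ` {q. P q})"
      by (simp add: basis_expansion)
  qed
qed

lemma WtV_support:
  "WtV {w. \<forall>i j. \<not> R i j \<longrightarrow> w $ (i, j) = 0} = {T. \<forall>i j k. \<not> R i j \<longrightarrow> T $ (i, j, k) = 0}"
  (is "WtV ?W = ?T")
proof
  show "WtV ?W \<subseteq> ?T"
    unfolding WtV_def by (rule vec.span_minimal) (auto simp: tens21_def vec.subspace_def)
next
  have "?T = vec.span ((\<lambda>q. axis q 1) ` {(i, j, k). R i j})"
    by (subst span_axis_eq_support) auto
  also have "\<dots> \<subseteq> WtV ?W"
    unfolding WtV_def
  proof (rule vec.span_mono, clarsimp)
    fix i j k assume "R i j"
    moreover have "axis (i, j, k) 1 = tens21 (axis (i, j) 1) (axis k 1)"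
      by (auto simp: vec_eq_iff tens21_def axis_def)
    ultimately show
      "\<exists>w. (\<exists>v. axis (i, j, k) 1 = tens21 w v) \<and> (\<forall>i j. \<not> R i j \<longrightarrow> w $ (i, j) = 0)"
      by (auto simp: axis_def)
  qed
  finally show "?T \<subseteq> WtV ?W" .
qed

lemma VtW_support:
  "VtW {w. \<forall>i j. \<not> R i j \<longrightarrow> w $ (i, j) = 0} = {T. \<forall>i j k. \<not> R j k \<longrightarrow> T $ (i, j, k) = 0}"
  (is "VtW ?W = ?T")
proof
  show "VtW ?W \<subseteq> ?T"
    unfolding VtW_def by (rule vec.span_minimal) (auto simp: tens12_def vec.subspace_def)
next
  have "?T = vec.span ((\<lambda>q. axis q 1) ` {(i, j, k). R j k})"
    by (subst span_axis_eq_support) auto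
  also have "\<dots> \<subseteq> VtW ?W"
    unfolding VtW_def
  proof (rule vec.span_mono, clarsimp)
    fix i j k assume "R j k"
    moreover have "axis (i, j, k) 1 = tens12 (axis i 1) (axis (j, k) 1)"
      by (auto simp: vec_eq_iff tens12_def axis_def)
    ultimately show
      "\<exists>v w. axis (i, j, k) 1 = tens12 v w \<and> (\<forall>i j. \<not> R i j \<longrightarrow> w $ (i, j) = 0)"
      by (intro exI[of _ "axis i 1"] exI[of _ "axis (j, k) 1"]) (auto simp: axis_def)
  qed
  finally show "?T \<subseteq> VtW ?W" .
qed

lemma E2_eq_axis: "E2 i j = axis (i, j) 1"
  by (auto simp: E2_def axis_def vec_eq_iff)

lemma Wp_vertex:
  assumes "(a, b, c) \<in> {(1, 0, 0), (0, 1, 0), (0, 0, 1)}"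
  obtains e where "Wp a b c = {w. \<forall>i j. j \<noteq> i + e \<longrightarrow> w $ (i, j) = 0}"
proof -
  have span_shift: "Wp a b c = {w. \<forall>i j. j \<noteq> i + e \<longrightarrow> w $ (i, j) = 0}"
    if "{(i, j). j = i + e} = P" "Wp a b c = vec.span ((\<lambda>q. axis q 1) ` P)" for e P
    using that span_axis_eq_support[of "\<lambda>(i, j). j = i + e"] by auto
  have orbit_1: "{(i, j). j = i + 1} = {(1, 2), (2, 0), (0, 1 :: 3)}"
    and orbit_2: "{(i, j). j = i + 2} = {(2, 1), (0, 2), (1, 0 :: 3)}"
    and orbit_0: "{(i, j). j = i + 0} = {(0, 0), (1, 1), (2, 2 :: 3)}"
    using exhaust_3_from_0 by fastforce+
  from assms consider "(a, b, c) = (1, 0, 0)" | "(a, b, c) = (0, 1, 0)" | "(a, b, c) = (0, 0, 1)"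
    by auto
  then show thesis
  proof cases
    case 1
    then show thesis
      by (intro that[of 1] span_shift[OF orbit_1]) (simp add: Wp_def E2_eq_axis insert_commute)
  next
    case 2
    then show thesis
      by (intro that[of 2] span_shift[OF orbit_2]) (simp add: Wp_def E2_eq_axis insert_commute)
  next
    case 3
    then show thesis
      by (intro that[of 0] span_shift[OF orbit_0]) (simp add: Wp_def E2_eq_axis insert_commute)
  qed
qed

definition cyclic_tensors :: "3 \<Rightarrow> ten3 set" where
  "cyclic_tensors e = {T. \<forall>i j k. \<not> (j = i + e \<and> k = j + e) \<longrightarrow> T $ (i, j, k) = 0}"

lemma WtV_inter_VtW_Wp_vertex:
  assumes "(a, b, c) \<in> {(1, 0, 0), (0, 1, 0), (0, 0, 1)}"
  obtains e where "WtV (Wp a b c) \<inter> VtW (Wp a b c) = cyclic_tensors e"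
proof -
  obtain e where W: "Wp a b c = {w. \<forall>i j. j \<noteq> i + e \<longrightarrow> w $ (i, j) = 0}"
    using Wp_vertex[OF assms] .
  have "WtV (Wp a b c) \<inter> VtW (Wp a b c) = cyclic_tensors e"
    unfolding W WtV_support[of "\<lambda>i j. j = i + e"] VtW_support[of "\<lambda>i j. j = i + e"]
      cyclic_tensors_def by blast
  then show thesis ..
qed

lemma pw_add:
  assumes "\<omega> ^ 3 = 1"
  shows "pw \<omega> (i + j) = pw \<omega> i * pw \<omega> j"
proof -
  have "\<omega> * \<omega> ^ 2 = 1" "\<omega> ^ 2 * \<omega> = 1" "\<omega> ^ 2 * \<omega> ^ 2 = \<omega>"
    using assms by algebra+
  then show ?thesis
    using exhaust_3_from_0[of i] exhaust_3_from_0[of j] by (auto simp: pw_def power2_eq_square)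
qed

lemma pw_mult_pw_neg:
  assumes "\<omega> ^ 3 = 1"
  shows "pw \<omega> (a * t) * pw \<omega> (- (b * t)) = pw \<omega> ((a - b) * t)"
  by (simp add: pw_add[OF assms, symmetric] algebra_simps)

lemma pw_orbit_product:
  assumes "\<omega> ^ 3 = 1"
  shows "pw \<omega> i * pw \<omega> (i + e) * pw \<omega> (i + e + e) = 1"
proof -
  have "pw \<omega> i * pw \<omega> (i + e) * pw \<omega> (i + e + e) = pw \<omega> (i + (i + e) + (i + e + e))"
    by (simp only: pw_add[OF assms])
  also have "i + (i + e) + (i + e + e) = 3 * (i + e)"
    by (simp add: algebra_simps)
  finally show ?thesis
    by (simp add: three_eq_zero pw_def)
qed

lemma sum_pw_mult:
  assumes "\<omega> ^ 3 = 1" "\<omega> \<noteq> 1"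
  shows "(\<Sum>t\<in>UNIV. pw \<omega> (d * t)) = (if d = 0 then 3 else 0)"
proof -
  have "(\<omega> - 1) * (1 + \<omega> + \<omega> ^ 2) = 0"
    using assms(1) by algebra
  then have "1 + \<omega> + \<omega> ^ 2 = 0"
    using assms(2) by simp
  then show ?thesis
    using exhaust_3_from_0[of d] by (auto simp: sum_3_from_0 pw_def ac_simps)
qed

text \<open>The image of \<open>axis a 1\<close> is the \<open>e\<^sub>1\<close>-eigenvector \<open>\<Sum>\<^sub>i \<omega>^(a i) m(i)\<close>, which spans
  the summand \<open>\<chi>\<^sub>a\<^sub>,\<^sub>0\<close>.\<close>

definition fourier_embed :: "complex \<Rightarrow> 3 \<Rightarrow> vecV \<Rightarrow> ten3" where
  "fourier_embed \<omega> e u = (\<chi> p. case p of (i, j, k) \<Rightarrow>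
     if j = i + e \<and> k = j + e then \<Sum>a\<in>UNIV. u $ a * pw \<omega> (a * i) else 0)"

definition fourier_coeff :: "complex \<Rightarrow> 3 \<Rightarrow> ten3 \<Rightarrow> vecV" where
  "fourier_coeff \<omega> e T = (\<chi> a. (\<Sum>t\<in>UNIV. T $ (t, t + e, t + e + e) * pw \<omega> (- (a * t))) / 3)"

lemma linear_fourier_embed: "Vector_Spaces.linear (*s) (*s) (fourier_embed \<omega> e)"
  by (auto simp: Vector_Spaces.linear_iff vec.vector_space_axioms fourier_embed_def vec_eq_iff
      sum.distrib distrib_right sum_distrib_left mult.assoc)

lemma fourier_embed_in_cyclic_tensors: "fourier_embed \<omega> e u \<in> cyclic_tensors e"
  by (simp add: fourier_embed_def cyclic_tensors_def)

lemma fourier_coeff_embed: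
  assumes "\<omega> ^ 3 = 1" "\<omega> \<noteq> 1"
  shows "fourier_coeff \<omega> e (fourier_embed \<omega> e u) = u"
proof -
  have "(\<Sum>t\<in>UNIV. (\<Sum>a\<in>UNIV. u $ a * pw \<omega> (a * t)) * pw \<omega> (- (b * t))) = 3 * u $ b" for b
  proof -
    have "(\<Sum>t\<in>UNIV. (\<Sum>a\<in>UNIV. u $ a * pw \<omega> (a * t)) * pw \<omega> (- (b * t)))
        = (\<Sum>t\<in>UNIV. \<Sum>a\<in>UNIV. u $ a * pw \<omega> ((a - b) * t))"
      by (simp add: sum_distrib_right mult.assoc pw_mult_pw_neg[OF assms(1)])
    also have "\<dots> = (\<Sum>a\<in>UNIV. u $ a * (\<Sum>t\<in>UNIV. pw \<omega> ((a - b) * t)))"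
      by (subst sum.swap) (simp add: sum_distrib_left)
    also have "\<dots> = (\<Sum>a\<in>UNIV. if a = b then 3 * u $ b else 0)"
      by (rule sum.cong) (simp_all add: sum_pw_mult[OF assms])
    finally show ?thesis
      by simp
  qed
  then show ?thesis
    by (simp add: fourier_coeff_def fourier_embed_def vec_eq_iff)
qed

lemma fourier_embed_coeff:
  assumes "\<omega> ^ 3 = 1" "\<omega> \<noteq> 1" and "T \<in> cyclic_tensors e"
  shows "fourier_embed \<omega> e (fourier_coeff \<omega> e T) = T"
proof -
  define c where "c t = T $ (t, t + e, t + e + e)" for t
  have "(\<Sum>a\<in>UNIV. (\<Sum>t\<in>UNIV. c t * pw \<omega> (- (a * t))) / 3 * pw \<omega> (a * i)) = c i" for i
  proof -
    have inner: "pw \<omega> (- (a * t)) * pw \<omega> (a * i) = pw \<omega> ((i - t) * a)" for a t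
      using pw_mult_pw_neg[OF assms(1), of i a t] by (simp add: mult.commute)
    have "(\<Sum>a\<in>UNIV. (\<Sum>t\<in>UNIV. c t * pw \<omega> (- (a * t))) / 3 * pw \<omega> (a * i))
        = (\<Sum>a\<in>UNIV. \<Sum>t\<in>UNIV. c t * (pw \<omega> (- (a * t)) * pw \<omega> (a * i))) / 3"
      by (simp add: sum_divide_distrib sum_distrib_right mult.assoc)
    also have "\<dots> = (\<Sum>a\<in>UNIV. \<Sum>t\<in>UNIV. c t * pw \<omega> ((i - t) * a)) / 3"
      by (simp only: inner)
    also have "\<dots> = (\<Sum>t\<in>UNIV. c t * (\<Sum>a\<in>UNIV. pw \<omega> ((i - t) * a))) / 3"
      by (subst sum.swap) (simp add: sum_distrib_left)
    also have "\<dots> = (\<Sum>t\<in>UNIV. if i = t then 3 * c i else 0) / 3"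
      by (rule arg_cong[where f = "\<lambda>x. x / 3"], rule sum.cong)
        (simp_all add: sum_pw_mult[OF assms(1,2)])
    finally show ?thesis
      by simp
  qed
  with assms(3) show ?thesis
    by (auto simp: fourier_coeff_def fourier_embed_def cyclic_tensors_def c_def vec_eq_iff)
qed

lemma bij_betw_fourier_embed:
  assumes "\<omega> ^ 3 = 1" "\<omega> \<noteq> 1"
  shows "bij_betw (fourier_embed \<omega> e) UNIV (cyclic_tensors e)"
  by (rule bij_betw_byWitness[where f' = "fourier_coeff \<omega> e"])
    (auto simp: fourier_coeff_embed[OF assms] fourier_embed_coeff[OF assms]
      fourier_embed_in_cyclic_tensors)

lemma fourier_embed_chiSum_e1:
  assumes "\<omega> ^ 3 = 1"
  shows "fourier_embed \<omega> e (chiSum_e1 \<omega> u) = act1 (fourier_embed \<omega> e u)"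
proof -
  have shift: "(j + 1 = i + 1 + e \<and> k + 1 = j + 1 + e) \<longleftrightarrow> (j = i + e \<and> k = j + e)" for i j k :: 3
    by (simp add: algebra_simps)
  have step: "(\<Sum>a\<in>UNIV. pw \<omega> a * u $ a * pw \<omega> (a * i))
      = (\<Sum>a\<in>UNIV. u $ a * pw \<omega> (a * (i + 1)))" for i
    by (simp add: pw_add[OF assms] distrib_left ac_simps)
  have "fourier_embed \<omega> e (chiSum_e1 \<omega> u) $ (i, j, k) = act1 (fourier_embed \<omega> e u) $ (i, j, k)"
    for i j k
    unfolding fourier_embed_def act1_def chiSum_e1_def vec_lambda_beta prod.case shift step ..
  then show ?thesis
    by (simp add: vec_eq_iff split_paired_All)
qed

lemma fourier_embed_chiSum_e2:
  assumes "\<omega> ^ 3 = 1"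
  shows "fourier_embed \<omega> e (chiSum_e2 \<omega> u) = act2 \<omega> (fourier_embed \<omega> e u)"
  using pw_orbit_product[OF assms]
  by (auto simp: vec_eq_iff fourier_embed_def act2_def chiSum_e2_def add.assoc)

lemma fixed_points_chiSum:
  assumes "\<omega> ^ 3 = 1" "\<omega> \<noteq> 1"
  shows "{u. chiSum_e1 \<omega> u = u \<and> chiSum_e2 \<omega> u = u} = vec.span {axis 0 1}"
proof -
  have "\<omega> ^ 2 \<noteq> 1"
  proof
    assume "\<omega> ^ 2 = 1"
    then have "\<omega> = \<omega> ^ 3"
      by (simp add: power3_eq_cube power2_eq_square)
    with assms show False
      by simp
  qed
  then have "chiSum_e1 \<omega> u = u \<longleftrightarrow> (\<forall>a. a \<noteq> 0 \<longrightarrow> u $ a = 0)" for u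
    using assms(2) exhaust_3_from_0 by (auto simp: chiSum_e1_def vec_eq_iff pw_def)
  moreover have "vec.span {axis 0 1} = {u :: vecV. \<forall>a. a \<noteq> 0 \<longrightarrow> u $ a = 0}"
    using span_axis_eq_support[of "\<lambda>a. a = 0"] by simp
  ultimately show ?thesis
    by (simp add: chiSum_e2_def)
qed

lemma fixed_points_equivariant_image:
  assumes "bij_betw f UNIV S" and "\<And>u. f (\<alpha> u) = \<beta> (f u)" and "\<And>u. f (\<alpha>' u) = \<beta>' (f u)"
  shows "{T \<in> S. \<beta> T = T \<and> \<beta>' T = T} = f ` {u. \<alpha> u = u \<and> \<alpha>' u = u}"
proof -
  have "inj f" and S: "S = range f"
    using assms(1) by (auto simp: bij_betw_def)
  then have "\<beta> (f u) = f u \<longleftrightarrow> \<alpha> u = u" "\<beta>' (f u) = f u \<longleftrightarrow> \<alpha>' u = u" for u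
    by (simp_all add: assms(2,3)[symmetric] inj_eq)
  with S show ?thesis
    by auto
qed

theorem mainTheorem6:
  fixes \<omega> a b c :: complex
  assumes "\<omega> ^ 3 = 1" and "\<omega> \<noteq> 1"
    and "(a, b, c) \<in> {(1, 0, 0), (0, 1, 0), (0, 0, 1)}"
  defines "S \<equiv> WtV (Wp a b c) \<inter> VtW (Wp a b c)"
  shows "(\<exists>f :: vecV \<Rightarrow> ten3.
            Vector_Spaces.linear (*s) (*s) f \<and> bij_betw f UNIV S \<and>
            (\<forall>u. f (chiSum_e1 \<omega> u) = act1 (f u)) \<and>
            (\<forall>u. f (chiSum_e2 \<omega> u) = act2 \<omega> (f u)))
       \<and> vec.dim {T \<in> S. act1 T = T \<and> act2 \<omega> T = T} = 1"
proof -
  obtain e where "WtV (Wp a b c) \<inter> VtW (Wp a b c) = cyclic_tensors e"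
    using WtV_inter_VtW_Wp_vertex[OF assms(3)] .
  then have S: "S = cyclic_tensors e"
    by (simp add: S_def)
  let ?f = "fourier_embed \<omega> e"
  have lin: "Vector_Spaces.linear (*s) (*s) ?f"
    by (rule linear_fourier_embed)
  have bij: "bij_betw ?f UNIV S"
    using bij_betw_fourier_embed[OF assms(1,2)] S by simp
  note e1 = fourier_embed_chiSum_e1[OF assms(1), of e]
    and e2 = fourier_embed_chiSum_e2[OF assms(1), of e]
  have "{T \<in> S. act1 T = T \<and> act2 \<omega> T = T} = ?f ` vec.span {axis 0 1}"
    using fixed_points_equivariant_image[where \<alpha> = "chiSum_e1 \<omega>" and \<alpha>' = "chiSum_e2 \<omega>",
        OF bij e1 e2] fixed_points_chiSum[OF assms(1,2)]
    by simp
  also have "\<dots> = vec.span {?f (axis 0 1)}"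
    using vec.linear_span_image[OF lin, of "{axis 0 1}"] by simp
  finally have "vec.dim {T \<in> S. act1 T = T \<and> act2 \<omega> T = T} = vec.dim {?f (axis 0 1)}"
    by simp
  moreover have "?f (axis 0 1) $ (0, e, e + e) = 1"
    by (simp add: fourier_embed_def axis_def pw_def)
  ultimately have "vec.dim {T \<in> S. act1 T = T \<and> act2 \<omega> T = T} = 1"
    by auto
  with lin bij e1 e2 show ?thesis
    by blast
qed

end
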